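(* In $L(\mathfrak{sl}_2)^+$ define, for $i\geq 0$, $A^{\downarrow\downarrow}_i=-x\otimes(t-1)^i$, $B^{\downarrow\downarrow}_i=(-y\otimes t-z\otimes(t-1))(t-1)^i$, $\psi^{\downarrow\downarrow}_i=(-x\otimes1-y\otimes t)(t-1)^{i-1}$. Then: (i) The elements $\{A^{\downarrow\downarrow}_i\}_{i\in\mathbb{N}}$ form a basis for $X^\sigma_{21}\cap O$. (ii) The elements $\{B^{\downarrow\downarrow}_i\}_{i\in\mathbb{N}}$ form a basis for $X^\sigma_{30}\cap O$. (iii) The elements $\{\psi^{\downarrow\downarrow}_{i+1}\}_{i\in\mathbb{N}}$ form a basis for $X^\sigma_{02}\cap O$.
   Context: $\mathbb{F}$ is a field of characteristic zero; $\mathbb{N}=\{0,1,2,\ldots\}$; $\mathbb{I}=\{0,1,2,3\}$; tensor products are over $\mathbb{F}$. The tetrahedron algebra $\boxtimes$ is the Lie algebra over $\mathbb{F}$ with generators $\{x_{ij}\mid i,j\in\mathbb{I},\ i\neq j\}$ and relations: $x_{ij}+x_{ji}=0$ for distinct $i,j$; $[x_{ij},x_{jk}]=2x_{ij}+2x_{jk}$ for mutually distinct $i,j,k$; $[x_{ij},[x_{ij},[x_{ij},x_{kh}]]]=4[x_{ij},x_{kh}]$ for mutually distinct $h,i,j,k$. For distinct $i,j\in\mathbb{I}$, $X_{ij}$ is the subspace of all $\xi\in\boxtimes$ ($x_{ij}$-like elements) with $[x_{ij},\xi]=0$ and $[x_{kh},[x_{kh},[x_{kh},\xi]]]=4[x_{kh},\xi]$,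 where $\{h,i,j,k\}=\mathbb{I}$; $X_{ij}=X_{ji}$. $\mathfrak{sl}_2$ has basis $e,f,h$ with $[h,e]=2e$, $[h,f]=-2f$, $[e,f]=h$, and equitable basis $x=2e-h$, $y=-2f-h$, $z=h$. $\mathcal{A}=\mathbb{F}[t,t^{-1},(t-1)^{-1}]$, $t$ an indeterminate, $t'=1-t^{-1}$, $t''=(1-t)^{-1}$. $L(\mathfrak{sl}_2)^+=\mathfrak{sl}_2\otimes\mathcal{A}$ with $[u\otimes a,v\otimes b]=[u,v]\otimes ab$; it is a right $\mathcal{A}$-module via $(u\otimes a)b=u\otimes ab$. $\sigma:\boxtimes\to L(\mathfrak{sl}_2)^+$ is the (unique) Lie algebra isomorphism with $x_{12}\mapsto x\otimes1$, $x_{23}\mapsto y\otimes1$, $x_{31}\mapsto z\otimes1$, $x_{03}\mapsto y\otimes t+z\otimes(t-1)$, $x_{01}\mapsto z\otimes t'+x\otimes(t'-1)$, $x_{02}\mapsto x\otimes t''+y\otimes(t''-1)$. $X^\sigma_{ij}$ denotes the image of $X_{ij}$ under $\sigma$. The Onsager Lie algebra $O$ (generators $A,B$; relations $[A,[A,[A,B]]]=4[A,B]$, $[B,[B,[B,A]]]=4[B,A]$) is identified with the Lie subalgebra of $L(\mathfrak{sl}_2)^+$ generated by $A=x\otimes1$ and $B=y\otimes t+z\otimes(t-1)$. *)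

theory Defs
  imports Complex_Main "HOL-Computational_Algebra.Polynomial" "HOL-Computational_Algebra.Fraction_Field"
begin

section \<open>Lie algebras\<close>

locale lie_algebra = vector_space scale
  for scale :: "'k::field \<Rightarrow> 'v::ab_group_add \<Rightarrow> 'v" (infixr \<open>*s\<close> 75) +
  fixes bracket :: "'v \<Rightarrow> 'v \<Rightarrow> 'v"
  assumes bracket_add_left: "bracket (u + v) w = bracket u w + bracket v w"
    and bracket_add_right: "bracket u (v + w) = bracket u v + bracket u w"
    and bracket_scale_left: "bracket (c *s u) v = c *s bracket u v"
    and bracket_scale_right: "bracket u (c *s v) = c *s bracket u v"
    and bracket_self: "bracket u u = 0"
    and jacobi: "bracket u (bracket v w) + bracket v (bracket w u) + bracket w (bracket u v) = 0"
begin

definition lie_subalgebra :: "'v set \<Rightarrow> bool" where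
  "lie_subalgebra S \<longleftrightarrow> subspace S \<and> (\<forall>u\<in>S. \<forall>v\<in>S. bracket u v \<in> S)"

definition generated_subalgebra :: "'v set \<Rightarrow> 'v set" where
  "generated_subalgebra G = \<Inter> {S. lie_subalgebra S \<and> G \<subseteq> S}"

end

definition lie_hom ::
    "('k::field \<Rightarrow> 'v::ab_group_add \<Rightarrow> 'v) \<Rightarrow> ('v \<Rightarrow> 'v \<Rightarrow> 'v) \<Rightarrow>
     ('k \<Rightarrow> 'w::ab_group_add \<Rightarrow> 'w) \<Rightarrow> ('w \<Rightarrow> 'w \<Rightarrow> 'w) \<Rightarrow> ('v \<Rightarrow> 'w) \<Rightarrow> bool" where
  "lie_hom s1 b1 s2 b2 \<phi> \<longleftrightarrow>
     Vector_Spaces.linear s1 s2 \<phi> \<and> (\<forall>u v. \<phi> (b1 u v) = b2 (\<phi> u) (\<phi> v))"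

definition lie_iso ::
    "('k::field \<Rightarrow> 'v::ab_group_add \<Rightarrow> 'v) \<Rightarrow> ('v \<Rightarrow> 'v \<Rightarrow> 'v) \<Rightarrow>
     ('k \<Rightarrow> 'w::ab_group_add \<Rightarrow> 'w) \<Rightarrow> ('w \<Rightarrow> 'w \<Rightarrow> 'w) \<Rightarrow> ('v \<Rightarrow> 'w) \<Rightarrow> bool" where
  "lie_iso s1 b1 s2 b2 \<phi> \<longleftrightarrow> lie_hom s1 b1 s2 b2 \<phi> \<and> bij \<phi>"

definition (in vector_space) family_basis :: "('i \<Rightarrow> 'b) \<Rightarrow> 'b set \<Rightarrow> bool" where
  "family_basis b W \<longleftrightarrow> inj b \<and> independent (range b) \<and> span (range b) = W"


section \<open>The tetrahedron algebra\<close>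

text \<open>The Lie algebra with the given generators and relations is constructed as the quotient of
  the formal Lie words in the generators by the congruence generated by the Lie algebra axioms and
  the defining relations; lemma \<open>tetra_universal\<close> below is its universal property.\<close>

definition II :: "nat set" where "II = {0, 1, 2, 3}"

typedef tetra_gen = "{(i, j). i \<in> II \<and> j \<in> II \<and> i \<noteq> j}"
  unfolding II_def by (rule exI[of _ "(0, 1)"]) simp

datatype 'f tetra_word =
    Gen tetra_gen
  | Zero
  | Add "'f tetra_word" "'f tetra_word"
  | Scale 'f "'f tetra_word"
  | Brk "'f tetra_word" "'f tetra_word"

abbreviation Xw :: "nat \<Rightarrow> nat \<Rightarrow> 'f tetra_word" where
  "Xw i j \<equiv> Gen (Abs_tetra_gen (i, j))"

inductive tetra_eq :: "'f::field tetra_word \<Rightarrow> 'f tetra_word \<Rightarrow> bool" where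
  eq_refl: "tetra_eq a a"
| eq_sym: "tetra_eq a b \<Longrightarrow> tetra_eq b a"
| eq_trans: "tetra_eq a b \<Longrightarrow> tetra_eq b c \<Longrightarrow> tetra_eq a c"
| cong_Add: "tetra_eq a a' \<Longrightarrow> tetra_eq b b' \<Longrightarrow> tetra_eq (Add a b) (Add a' b')"
| cong_Scale: "tetra_eq a a' \<Longrightarrow> tetra_eq (Scale c a) (Scale c a')"
| cong_Brk: "tetra_eq a a' \<Longrightarrow> tetra_eq b b' \<Longrightarrow> tetra_eq (Brk a b) (Brk a' b')"
| Add_assoc: "tetra_eq (Add (Add a b) c) (Add a (Add b c))"
| Add_comm: "tetra_eq (Add a b) (Add b a)"
| Add_Zero: "tetra_eq (Add Zero a) a"
| Add_neg: "tetra_eq (Add (Scale (- 1) a) a) Zero"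
| Scale_Add: "tetra_eq (Scale r (Add a b)) (Add (Scale r a) (Scale r b))"
| Scale_plus: "tetra_eq (Scale (r + s) a) (Add (Scale r a) (Scale s a))"
| Scale_Scale: "tetra_eq (Scale r (Scale s a)) (Scale (r * s) a)"
| Scale_one: "tetra_eq (Scale 1 a) a"
| Brk_Add_left: "tetra_eq (Brk (Add a b) c) (Add (Brk a c) (Brk b c))"
| Brk_Add_right: "tetra_eq (Brk a (Add b c)) (Add (Brk a b) (Brk a c))"
| Brk_Scale_left: "tetra_eq (Brk (Scale r a) b) (Scale r (Brk a b))"
| Brk_Scale_right: "tetra_eq (Brk a (Scale r b)) (Scale r (Brk a b))"
| Brk_self: "tetra_eq (Brk a a) Zero"
| Brk_jacobi: "tetra_eq (Add (Add (Brk a (Brk b c)) (Brk b (Brk c a))) (Brk c (Brk a b))) Zero"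
| rel_skew: "\<lbrakk>i \<in> II; j \<in> II; i \<noteq> j\<rbrakk> \<Longrightarrow> tetra_eq (Add (Xw i j) (Xw j i)) Zero"
| rel_triple: "\<lbrakk>i \<in> II; j \<in> II; k \<in> II; distinct [i, j, k]\<rbrakk> \<Longrightarrow>
    tetra_eq (Brk (Xw i j) (Xw j k)) (Add (Scale 2 (Xw i j)) (Scale 2 (Xw j k)))"
| rel_dolan_grady: "\<lbrakk>h \<in> II; i \<in> II; j \<in> II; k \<in> II; distinct [h, i, j, k]\<rbrakk> \<Longrightarrow>
    tetra_eq (Brk (Xw i j) (Brk (Xw i j) (Brk (Xw i j) (Xw k h)))) (Scale 4 (Brk (Xw i j) (Xw k h)))"

quotient_type (overloaded) 'f tetra = "'f::field tetra_word" / tetra_eq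
  by (intro equivpI reflpI sympI transpI) (auto intro: eq_refl eq_sym eq_trans)

instantiation tetra :: (field) ab_group_add
begin

lift_definition zero_tetra :: "'a tetra" is Zero .
lift_definition plus_tetra :: "'a tetra \<Rightarrow> 'a tetra \<Rightarrow> 'a tetra" is Add by (rule cong_Add)
lift_definition uminus_tetra :: "'a tetra \<Rightarrow> 'a tetra" is "Scale (- 1)" by (rule cong_Scale)
definition minus_tetra :: "'a tetra \<Rightarrow> 'a tetra \<Rightarrow> 'a tetra" where "minus_tetra a b = a + - b"

instance
proof
  fix a b c :: "'a tetra"
  show "a + b + c = a + (b + c)" by transfer (rule Add_assoc)
  show "a + b = b + a" by transfer (rule Add_comm)
  show "0 + a = a" by transfer (rule Add_Zero)
  show "- a + a = 0" by transfer (rule Add_neg)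
  show "a - b = a + - b" by (rule minus_tetra_def)
qed

end

lift_definition tetra_scale :: "'f::field \<Rightarrow> 'f tetra \<Rightarrow> 'f tetra" is Scale by (rule cong_Scale)
lift_definition tetra_bracket :: "'f::field tetra \<Rightarrow> 'f tetra \<Rightarrow> 'f tetra" is Brk by (rule cong_Brk)

text \<open>Only meaningful for distinct \<open>i, j \<in> II\<close>.\<close>
lift_definition tetra_x :: "nat \<Rightarrow> nat \<Rightarrow> 'f::field tetra" is Xw .

global_interpretation tetra: lie_algebra tetra_scale tetra_bracket
proof unfold_locales
  fix a b c :: "'a tetra" and r s :: 'a
  show "tetra_scale r (a + b) = tetra_scale r a + tetra_scale r b" by transfer (rule Scale_Add)
  show "tetra_scale (r + s) a = tetra_scale r a + tetra_scale s a" by transfer (rule Scale_plus)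
  show "tetra_scale r (tetra_scale s a) = tetra_scale (r * s) a" by transfer (rule Scale_Scale)
  show "tetra_scale 1 a = a" by transfer (rule Scale_one)
  show "tetra_bracket (a + b) c = tetra_bracket a c + tetra_bracket b c"
    by transfer (rule Brk_Add_left)
  show "tetra_bracket a (b + c) = tetra_bracket a b + tetra_bracket a c"
    by transfer (rule Brk_Add_right)
  show "tetra_bracket (tetra_scale r a) b = tetra_scale r (tetra_bracket a b)"
    by transfer (rule Brk_Scale_left)
  show "tetra_bracket a (tetra_scale r b) = tetra_scale r (tetra_bracket a b)"
    by transfer (rule Brk_Scale_right)
  show "tetra_bracket a a = 0" by transfer (rule Brk_self)
  show "tetra_bracket a (tetra_bracket b c) + tetra_bracket b (tetra_bracket c a) +
      tetra_bracket c (tetra_bracket a b) = 0"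
    by transfer (rule Brk_jacobi)
qed

definition tetra_relations ::
    "('k::field \<Rightarrow> 'v::ab_group_add \<Rightarrow> 'v) \<Rightarrow> ('v \<Rightarrow> 'v \<Rightarrow> 'v) \<Rightarrow> (nat \<Rightarrow> nat \<Rightarrow> 'v) \<Rightarrow> bool" where
  "tetra_relations s br y \<longleftrightarrow>
     (\<forall>i\<in>II. \<forall>j\<in>II. i \<noteq> j \<longrightarrow> y i j + y j i = 0) \<and>
     (\<forall>i\<in>II. \<forall>j\<in>II. \<forall>k\<in>II. distinct [i, j, k] \<longrightarrow>
        br (y i j) (y j k) = s 2 (y i j) + s 2 (y j k)) \<and>
     (\<forall>h\<in>II. \<forall>i\<in>II. \<forall>j\<in>II. \<forall>k\<in>II. distinct [h, i, j, k] \<longrightarrow>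
        br (y i j) (br (y i j) (br (y i j) (y k h))) = s 4 (br (y i j) (y k h)))"

lemma tetra_relations_tetra: "tetra_relations tetra_scale tetra_bracket tetra_x"
  unfolding tetra_relations_def
proof (intro conjI ballI impI)
  fix i j assume "i \<in> II" "j \<in> II" "i \<noteq> j"
  then show "tetra_x i j + tetra_x j i = (0 :: 'a tetra)" by transfer (rule rel_skew)
next
  fix i j k assume "i \<in> II" "j \<in> II" "k \<in> II" "distinct [i, j, k]"
  then show "tetra_bracket (tetra_x i j) (tetra_x j k) =
      tetra_scale 2 (tetra_x i j) + (tetra_scale 2 (tetra_x j k) :: 'a tetra)"
    by transfer (rule rel_triple)
next
  fix h i j k assume "h \<in> II" "i \<in> II" "j \<in> II" "k \<in> II" "distinct [h, i, j, k]"
  then show "tetra_bracket (tetra_x i j) (tetra_bracket (tetra_x i j)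
      (tetra_bracket (tetra_x i j) (tetra_x k h))) =
      (tetra_scale 4 (tetra_bracket (tetra_x i j) (tetra_x k h)) :: 'a tetra)"
    by transfer (rule rel_dolan_grady)
qed

context
  fixes s :: "'f::field \<Rightarrow> 'v::ab_group_add \<Rightarrow> 'v" and br :: "'v \<Rightarrow> 'v \<Rightarrow> 'v"
    and y :: "nat \<Rightarrow> nat \<Rightarrow> 'v"
begin

primrec word_eval :: "'f tetra_word \<Rightarrow> 'v" where
  "word_eval (Gen g) = y (fst (Rep_tetra_gen g)) (snd (Rep_tetra_gen g))"
| "word_eval Zero = 0"
| "word_eval (Add a b) = word_eval a + word_eval b"
| "word_eval (Scale r a) = s r (word_eval a)"
| "word_eval (Brk a b) = br (word_eval a) (word_eval b)"

end

lemma word_eval_Xw: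
  "i \<in> II \<Longrightarrow> j \<in> II \<Longrightarrow> i \<noteq> j \<Longrightarrow> word_eval s br y (Xw i j) = y i j"
  by (simp add: Abs_tetra_gen_inverse)

lemma word_eval_cong:
  assumes "lie_algebra s br" and rel: "tetra_relations s br y" and "tetra_eq a b"
  shows "word_eval s br y a = word_eval s br y b"
proof -
  interpret L: lie_algebra s br by fact
  note L.bracket_add_left[simp] L.bracket_add_right[simp] L.bracket_scale_left[simp]
    L.bracket_scale_right[simp] L.bracket_self[simp] L.jacobi[simp]
  show ?thesis
    using \<open>tetra_eq a b\<close>
  proof induction
    case (rel_skew i j)
    then show ?case using rel by (simp add: word_eval_Xw tetra_relations_def del: word_eval.simps(1))
  next
    case (rel_triple i j k)
    then show ?case using rel by (simp add: word_eval_Xw tetra_relations_def del: word_eval.simps(1))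
  next
    case (rel_dolan_grady h i j k)
    then show ?case using rel by (simp add: word_eval_Xw tetra_relations_def del: word_eval.simps(1))
  next
    case (Add_comm a b)
    then show ?case by (simp add: add.commute)
  qed (simp_all add: add.assoc[symmetric] L.scale_right_distrib L.scale_left_distrib)
qed

theorem tetra_universal:
  fixes s :: "'f::field \<Rightarrow> 'v::ab_group_add \<Rightarrow> 'v"
  assumes lie: "lie_algebra s br" and rel: "tetra_relations s br y"
  shows "\<exists>!\<phi>. lie_hom tetra_scale tetra_bracket s br \<phi> \<and>
           (\<forall>i\<in>II. \<forall>j\<in>II. i \<noteq> j \<longrightarrow> \<phi> (tetra_x i j) = y i j)"
proof (rule ex_ex1I)
  interpret L: lie_algebra s br by fact
  have vs: "vector_space (tetra_scale :: 'f \<Rightarrow> _)" "vector_space s" by unfold_locales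
  define \<phi> where "\<phi> \<xi> = word_eval s br y (rep_tetra \<xi>)" for \<xi>
  have abs: "\<phi> (abs_tetra w) = word_eval s br y w" for w
    unfolding \<phi>_def
    by (rule word_eval_cong[OF lie rel Quotient3_rep_abs[OF Quotient3_tetra eq_refl]])
  have "\<phi> (a + b) = \<phi> a + \<phi> b" "\<phi> (tetra_scale r a) = s r (\<phi> a)"
    "\<phi> (tetra_bracket a b) = br (\<phi> a) (\<phi> b)" for a b r
    by (induct a rule: tetra.abs_induct, induct b rule: tetra.abs_induct,
        simp add: abs plus_tetra.abs_eq tetra_scale.abs_eq tetra_bracket.abs_eq)+
  moreover have "\<phi> (tetra_x i j) = y i j" if "i \<in> II" "j \<in> II" "i \<noteq> j" for i j
    using word_eval_Xw[OF that, of s br y] by (simp add: tetra_x_def abs)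
  ultimately show "\<exists>\<phi>. lie_hom tetra_scale tetra_bracket s br \<phi> \<and>
      (\<forall>i\<in>II. \<forall>j\<in>II. i \<noteq> j \<longrightarrow> \<phi> (tetra_x i j) = y i j)"
    using vs unfolding lie_hom_def Vector_Spaces.linear_iff by blast
next
  fix \<phi> \<psi> :: "'f tetra \<Rightarrow> 'v"
  assume \<phi>: "lie_hom tetra_scale tetra_bracket s br \<phi> \<and>
      (\<forall>i\<in>II. \<forall>j\<in>II. i \<noteq> j \<longrightarrow> \<phi> (tetra_x i j) = y i j)"
    and \<psi>: "lie_hom tetra_scale tetra_bracket s br \<psi> \<and>
      (\<forall>i\<in>II. \<forall>j\<in>II. i \<noteq> j \<longrightarrow> \<psi> (tetra_x i j) = y i j)"
  have "\<phi> (abs_tetra w) = \<psi> (abs_tetra w)" for w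
  proof (induction w)
    case (Gen g)
    obtain i j where g: "g = Abs_tetra_gen (i, j)" "i \<in> II" "j \<in> II" "i \<noteq> j"
      by (cases g) auto
    then have "abs_tetra (Gen g) = (tetra_x i j :: 'f tetra)" by (simp add: tetra_x_def)
    then show ?case using \<phi> \<psi> g by simp
  next
    case Zero
    have "\<phi> 0 = 0" "\<psi> 0 = 0"
      using \<phi> \<psi> by (auto simp: lie_hom_def linear_iff_module_hom module_hom.zero)
    then show ?case by (simp add: zero_tetra_def)
  next
    case (Add a b)
    then show ?case using \<phi> \<psi> by (simp add: plus_tetra.abs_eq[symmetric] lie_hom_def Vector_Spaces.linear_iff)
  next
    case (Scale r a)
    then show ?case using \<phi> \<psi> by (simp add: tetra_scale.abs_eq[symmetric] lie_hom_def Vector_Spaces.linear_iff)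
  next
    case (Brk a b)
    then show ?case using \<phi> \<psi> by (simp add: tetra_bracket.abs_eq[symmetric] lie_hom_def)
  qed
  from this[of "rep_tetra _"] show "\<phi> = \<psi>"
    by (intro ext) (simp add: Quotient3_abs_rep[OF Quotient3_tetra])
qed

definition tetra_X :: "nat \<Rightarrow> nat \<Rightarrow> 'f::field tetra set" where
  "tetra_X i j = {\<xi>. tetra_bracket (tetra_x i j) \<xi> = 0 \<and>
     (\<forall>h k. {h, i, j, k} = II \<longrightarrow>
        tetra_bracket (tetra_x k h) (tetra_bracket (tetra_x k h) (tetra_bracket (tetra_x k h) \<xi>)) =
        tetra_scale 4 (tetra_bracket (tetra_x k h) \<xi>))}"


section \<open>The ring \<open>\<A> = \<F>[t, t\<^sup>-\<^sup>1, (t - 1)\<^sup>-\<^sup>1]\<close>\<close>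

text \<open>Realized as the subring of the field of fractions of \<open>\<F>[t]\<close> generated by \<open>\<F>[t]\<close> and
  the inverses of \<open>t\<close> and \<open>t - 1\<close>.\<close>

abbreviation Tfr :: "'f::field poly fract" where "Tfr \<equiv> Fract [:0, 1:] 1"

inductive_set A_carrier :: "'f::field poly fract set" where
  poly: "Fract p 1 \<in> A_carrier"
| inv_t: "inverse Tfr \<in> A_carrier"
| inv_t1: "inverse (Tfr - 1) \<in> A_carrier"
| add: "a \<in> A_carrier \<Longrightarrow> b \<in> A_carrier \<Longrightarrow> a + b \<in> A_carrier"
| mult: "a \<in> A_carrier \<Longrightarrow> b \<in> A_carrier \<Longrightarrow> a * b \<in> A_carrier"

typedef (overloaded) 'f A_ring = "A_carrier :: 'f::field poly fract set"
  by (rule exI, rule A_carrier.poly)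

setup_lifting type_definition_A_ring

lemma A_carrier_0: "0 \<in> A_carrier" and A_carrier_1: "1 \<in> A_carrier"
  using A_carrier.poly[of 0] A_carrier.poly[of 1] by (simp_all add: Zero_fract_def One_fract_def)

lemma A_carrier_uminus: "a \<in> A_carrier \<Longrightarrow> - a \<in> A_carrier"
  using A_carrier.mult[OF A_carrier.poly[of "- 1"], of a]
  by (simp add: minus_fract[symmetric] One_fract_def[symmetric])

lemma A_carrier_diff: "a \<in> A_carrier \<Longrightarrow> b \<in> A_carrier \<Longrightarrow> a - b \<in> A_carrier"
  using A_carrier.add[OF _ A_carrier_uminus, of a b] by simp

lemma A_carrier_power: "a \<in> A_carrier \<Longrightarrow> a ^ n \<in> A_carrier"
  by (induction n) (auto intro: A_carrier_1 A_carrier.mult)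

instantiation A_ring :: (field) idom
begin

lift_definition zero_A_ring :: "'a A_ring" is 0 by (rule A_carrier_0)
lift_definition one_A_ring :: "'a A_ring" is 1 by (rule A_carrier_1)
lift_definition plus_A_ring :: "'a A_ring \<Rightarrow> 'a A_ring \<Rightarrow> 'a A_ring" is "(+)"
  by (rule A_carrier.add)
lift_definition times_A_ring :: "'a A_ring \<Rightarrow> 'a A_ring \<Rightarrow> 'a A_ring" is "(*)"
  by (rule A_carrier.mult)
lift_definition uminus_A_ring :: "'a A_ring \<Rightarrow> 'a A_ring" is uminus by (rule A_carrier_uminus)
lift_definition minus_A_ring :: "'a A_ring \<Rightarrow> 'a A_ring \<Rightarrow> 'a A_ring" is "(-)"
  by (rule A_carrier_diff)

instance
  by standard (transfer; simp add: algebra_simps)+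

end

lift_definition A_const :: "'f::field \<Rightarrow> 'f A_ring" is "\<lambda>c. Fract [:c:] 1"
  by (rule A_carrier.poly)
lift_definition A_t :: "'f::field A_ring" is Tfr by (rule A_carrier.poly)
lift_definition A_t' :: "'f::field A_ring" is "1 - inverse Tfr"
  by (intro A_carrier_diff A_carrier_1 A_carrier.inv_t)
lift_definition A_t'' :: "'f::field A_ring" is "inverse (1 - Tfr)"
proof -
  have "inverse (1 - Tfr) = - inverse (Tfr - 1 :: 'f poly fract)"
    by (metis inverse_minus_eq minus_diff_eq)
  then show "inverse (1 - Tfr) \<in> (A_carrier :: 'f poly fract set)"
    by (simp add: A_carrier_uminus A_carrier.inv_t1)
qed
lift_definition A_t1_powi :: "int \<Rightarrow> 'f::field A_ring" is "\<lambda>k. (Tfr - 1) powi k"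
  unfolding power_int_def
  by (auto intro!: A_carrier_power A_carrier.inv_t1 A_carrier_diff A_carrier.poly A_carrier_1)

lemma A_const_simps:
  "A_const 0 = 0" "A_const 1 = 1" "A_const (a + b) = A_const a + A_const b"
  "A_const (a * b) = A_const a * A_const b" "A_const (a - b) = A_const a - A_const b"
  by (transfer; simp add: Zero_fract_def One_fract_def one_pCons)+

lemma A_t1_powi_of_nat: "A_t1_powi (int n) = (A_t - 1) ^ n"
proof -
  have "Rep_A_ring ((A_t - 1) ^ n :: 'a A_ring) = (Tfr - 1) ^ n"
    by (induction n) (simp_all add: one_A_ring.rep_eq times_A_ring.rep_eq minus_A_ring.rep_eq A_t.rep_eq)
  then show ?thesis by (simp add: Rep_A_ring_inject[symmetric] A_t1_powi.rep_eq)
qed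


section \<open>\<open>sl\<^sub>2\<close> and \<open>L(sl\<^sub>2)\<^sup>+\<close>\<close>

text \<open>\<open>SL2 a b c\<close> is \<open>a e + b f + c h\<close>. With coefficients in \<open>\<F>\<close> this is
  \<open>sl\<^sub>2\<close>; since \<open>e, f, h\<close> is a basis, with coefficients in \<open>\<A>\<close> it is \<open>sl\<^sub>2 \<otimes> \<A>\<close>
  (see lemmas \<open>tensor_universal\<close> and \<open>loop_bracket_tensor\<close>).\<close>

datatype 'r sl2 = SL2 (coef_e: 'r) (coef_f: 'r) (coef_h: 'r)

instantiation sl2 :: (ab_group_add) ab_group_add
begin

definition zero_sl2 :: "'a sl2" where "zero_sl2 = SL2 0 0 0"
definition plus_sl2 :: "'a sl2 \<Rightarrow> 'a sl2 \<Rightarrow> 'a sl2" where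
  "plus_sl2 u v = SL2 (coef_e u + coef_e v) (coef_f u + coef_f v) (coef_h u + coef_h v)"
definition uminus_sl2 :: "'a sl2 \<Rightarrow> 'a sl2" where
  "uminus_sl2 u = SL2 (- coef_e u) (- coef_f u) (- coef_h u)"
definition minus_sl2 :: "'a sl2 \<Rightarrow> 'a sl2 \<Rightarrow> 'a sl2" where
  "minus_sl2 u v = SL2 (coef_e u - coef_e v) (coef_f u - coef_f v) (coef_h u - coef_h v)"

instance
  by standard
    (simp_all add: zero_sl2_def plus_sl2_def uminus_sl2_def minus_sl2_def algebra_simps sl2.expand)

end

lemmas sl2_arith = zero_sl2_def plus_sl2_def uminus_sl2_def minus_sl2_def

definition sl2_scale :: "'r::comm_ring_1 \<Rightarrow> 'r sl2 \<Rightarrow> 'r sl2" where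
  "sl2_scale r u = SL2 (r * coef_e u) (r * coef_f u) (r * coef_h u)"

text \<open>The bilinear extension of \<open>[h,e] = 2e\<close>, \<open>[h,f] = -2f\<close>, \<open>[e,f] = h\<close>.\<close>
definition sl2_bracket :: "'r::comm_ring_1 sl2 \<Rightarrow> 'r sl2 \<Rightarrow> 'r sl2" where
  "sl2_bracket u v = SL2
     (2 * (coef_h u * coef_e v - coef_e u * coef_h v))
     (- 2 * (coef_h u * coef_f v - coef_f u * coef_h v))
     (coef_e u * coef_f v - coef_f u * coef_e v)"

definition sl2_e :: "'f::field sl2" where "sl2_e = SL2 1 0 0"
definition sl2_f :: "'f::field sl2" where "sl2_f = SL2 0 1 0"
definition sl2_h :: "'f::field sl2" where "sl2_h = SL2 0 0 1"

lemma sl2_bracket_basis: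
  "sl2_bracket sl2_h sl2_e = sl2_scale 2 sl2_e"
  "sl2_bracket sl2_h sl2_f = sl2_scale (- 2) sl2_f"
  "sl2_bracket sl2_e sl2_f = sl2_h"
  by (simp_all add: sl2_bracket_def sl2_scale_def sl2_e_def sl2_f_def sl2_h_def)

definition sl2_x :: "'f::field sl2" where "sl2_x = sl2_scale 2 sl2_e - sl2_h"
definition sl2_y :: "'f::field sl2" where "sl2_y = sl2_scale (- 2) sl2_f - sl2_h"
definition sl2_z :: "'f::field sl2" where "sl2_z = sl2_h"

global_interpretation sl2: lie_algebra "sl2_scale :: 'f::field \<Rightarrow> _" sl2_bracket
  by unfold_locales (simp_all add: sl2_scale_def sl2_bracket_def sl2_arith algebra_simps)

type_synonym 'f loop_sl2 = "'f A_ring sl2"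

definition tensor :: "'f::field sl2 \<Rightarrow> 'f A_ring \<Rightarrow> 'f loop_sl2" (infix \<open>\<otimes>\<close> 72) where
  "u \<otimes> a = SL2 (A_const (coef_e u) * a) (A_const (coef_f u) * a) (A_const (coef_h u) * a)"

definition A_scale :: "'f::field \<Rightarrow> 'f A_ring \<Rightarrow> 'f A_ring" where
  "A_scale c a = A_const c * a"

definition loop_scale :: "'f::field \<Rightarrow> 'f loop_sl2 \<Rightarrow> 'f loop_sl2" where
  "loop_scale c v = sl2_scale (A_const c) v"

definition loop_bracket :: "'f::field loop_sl2 \<Rightarrow> 'f loop_sl2 \<Rightarrow> 'f loop_sl2" where
  "loop_bracket = sl2_bracket"

definition loop_mult :: "'f::field loop_sl2 \<Rightarrow> 'f A_ring \<Rightarrow> 'f loop_sl2" (infixl \<open>\<odot>\<close> 72) where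
  "v \<odot> b = sl2_scale b v"

global_interpretation loop: lie_algebra "loop_scale :: 'f::field \<Rightarrow> _" loop_bracket
  by unfold_locales
    (simp_all add: loop_scale_def loop_bracket_def sl2_scale_def sl2_bracket_def sl2_arith
      A_const_simps algebra_simps)

lemma loop_bracket_tensor: "loop_bracket (u \<otimes> a) (v \<otimes> b) = sl2_bracket u v \<otimes> (a * b)"
proof -
  have "A_const (2::'a) = 2" "A_const (- 2 * c) = - 2 * A_const c" for c :: 'a
    using A_const_simps(3)[of 1 "1::'a"] A_const_simps(5)[of 0 "2 * c"] A_const_simps(4)[of 2 c]
    by (simp_all add: A_const_simps)
  then show ?thesis
    by (simp add: loop_bracket_def sl2_bracket_def tensor_def A_const_simps algebra_simps)
qed

lemma loop_mult_tensor: "(u \<otimes> a) \<odot> b = u \<otimes> (a * b)"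
  by (simp add: loop_mult_def tensor_def sl2_scale_def algebra_simps)

global_interpretation A_ring: vector_space "A_scale :: 'f::field \<Rightarrow> _"
  by unfold_locales (simp_all add: A_scale_def A_const_simps algebra_simps)

lemma tensor_bilinear:
  fixes u v :: "'f::field sl2"
  shows "(u + v) \<otimes> a = u \<otimes> a + v \<otimes> a" "u \<otimes> (a + b) = u \<otimes> a + u \<otimes> b"
    "sl2_scale c u \<otimes> a = loop_scale c (u \<otimes> a)" "u \<otimes> A_scale c a = loop_scale c (u \<otimes> a)"
  by (simp_all add: tensor_def sl2_scale_def loop_scale_def A_scale_def sl2_arith
      A_const_simps algebra_simps)

lemma loop_decomp: "v = sl2_e \<otimes> coef_e v + sl2_f \<otimes> coef_f v + sl2_h \<otimes> coef_h v"
  by (cases v) (simp add: tensor_def sl2_e_def sl2_f_def sl2_h_def sl2_arith A_const_simps)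

theorem tensor_universal:
  fixes s :: "'f::field \<Rightarrow> 'w::ab_group_add \<Rightarrow> 'w" and \<beta> :: "'f sl2 \<Rightarrow> 'f A_ring \<Rightarrow> 'w"
  assumes "vector_space s"
    and lin1: "\<And>a. Vector_Spaces.linear sl2_scale s (\<lambda>u. \<beta> u a)"
    and lin2: "\<And>u. Vector_Spaces.linear A_scale s (\<beta> u)"
  shows "\<exists>!\<phi>. Vector_Spaces.linear loop_scale s \<phi> \<and> (\<forall>u a. \<phi> (u \<otimes> a) = \<beta> u a)"
proof (rule ex_ex1I)
  interpret W: vector_space s by fact
  have vs: "vector_space (loop_scale :: 'f \<Rightarrow> _)" by unfold_locales
  define \<phi> where "\<phi> v = \<beta> sl2_e (coef_e v) + \<beta> sl2_f (coef_f v) + \<beta> sl2_h (coef_h v)" for v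
  have add1: "\<beta> (u + v) a = \<beta> u a + \<beta> v a" and scale1: "\<beta> (sl2_scale c u) a = s c (\<beta> u a)" for u v a c
    using lin1[of a] unfolding Vector_Spaces.linear_iff by auto
  have add2: "\<beta> u (a + b) = \<beta> u a + \<beta> u b" and scale2: "\<beta> u (A_const c * a) = s c (\<beta> u a)" for u a b c
    using lin2[of u] unfolding Vector_Spaces.linear_iff A_scale_def by auto
  have "\<phi> (v + w) = \<phi> v + \<phi> w" "\<phi> (loop_scale c v) = s c (\<phi> v)" for v w c
    by (simp_all add: \<phi>_def plus_sl2_def loop_scale_def sl2_scale_def add2 scale2
        W.scale_right_distrib)
  moreover have "\<phi> (u \<otimes> a) = \<beta> u a" for u a
  proof -
    have "u = sl2_scale (coef_e u) sl2_e + sl2_scale (coef_f u) sl2_f + sl2_scale (coef_h u) sl2_h"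
      by (cases u) (simp add: sl2_e_def sl2_f_def sl2_h_def sl2_scale_def sl2_arith)
    then have "\<beta> u a = s (coef_e u) (\<beta> sl2_e a) + s (coef_f u) (\<beta> sl2_f a) + s (coef_h u) (\<beta> sl2_h a)"
      by (metis add1 scale1)
    then show ?thesis by (simp add: \<phi>_def tensor_def scale2)
  qed
  ultimately show "\<exists>\<phi>. Vector_Spaces.linear loop_scale s \<phi> \<and> (\<forall>u a. \<phi> (u \<otimes> a) = \<beta> u a)"
    using vs \<open>vector_space s\<close> unfolding Vector_Spaces.linear_iff by blast
next
  fix \<phi> \<psi>
  assume "Vector_Spaces.linear loop_scale s \<phi> \<and> (\<forall>u a. \<phi> (u \<otimes> a) = \<beta> u a)"
    "Vector_Spaces.linear loop_scale s \<psi> \<and> (\<forall>u a. \<psi> (u \<otimes> a) = \<beta> u a)"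
  then show "\<phi> = \<psi>"
    unfolding Vector_Spaces.linear_iff by (intro ext) (metis loop_decomp)
qed


section \<open>The isomorphism \<open>\<sigma>\<close>, the Onsager algebra and the elements \<open>A\<^sub>i, B\<^sub>i, \<psi>\<^sub>i\<close>\<close>

definition is_sigma :: "('f::field tetra \<Rightarrow> 'f loop_sl2) \<Rightarrow> bool" where
  "is_sigma \<sigma> \<longleftrightarrow>
     lie_iso tetra_scale tetra_bracket loop_scale loop_bracket \<sigma> \<and>
     \<sigma> (tetra_x 1 2) = sl2_x \<otimes> 1 \<and>
     \<sigma> (tetra_x 2 3) = sl2_y \<otimes> 1 \<and>
     \<sigma> (tetra_x 3 1) = sl2_z \<otimes> 1 \<and>
     \<sigma> (tetra_x 0 3) = sl2_y \<otimes> A_t + sl2_z \<otimes> (A_t - 1) \<and>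
     \<sigma> (tetra_x 0 1) = sl2_z \<otimes> A_t' + sl2_x \<otimes> (A_t' - 1) \<and>
     \<sigma> (tetra_x 0 2) = sl2_x \<otimes> A_t'' + sl2_y \<otimes> (A_t'' - 1)"

definition onsager :: "'f::field loop_sl2 set" where
  "onsager = loop.generated_subalgebra {sl2_x \<otimes> 1, sl2_y \<otimes> A_t + sl2_z \<otimes> (A_t - 1)}"

definition A_dd :: "nat \<Rightarrow> 'f::field loop_sl2" where
  "A_dd i = - (sl2_x \<otimes> (A_t - 1) ^ i)"

definition B_dd :: "nat \<Rightarrow> 'f::field loop_sl2" where
  "B_dd i = (- (sl2_y \<otimes> A_t) - sl2_z \<otimes> (A_t - 1)) \<odot> (A_t - 1) ^ i"

text \<open>For \<open>i = 0\<close> the exponent is \<open>-1\<close>.\<close>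
definition psi_dd :: "nat \<Rightarrow> 'f::field loop_sl2" where
  "psi_dd i = (- (sl2_x \<otimes> 1) - sl2_y \<otimes> A_t) \<odot> A_t1_powi (int i - 1)"

end

theory Submission
  imports Defs
begin

text \<open>For \<open>u = a e + b f + c h\<close> one has \<open>(ad u)\<^sup>3 = 4 (c\<^sup>2 + a b) ad u\<close>, and
  \<open>c\<^sup>2 + a b = 1\<close> for every \<open>\<sigma> x\<^sub>i\<^sub>j\<close>, so the cubic condition in the definition of
  \<open>X\<^sub>i\<^sub>j\<close> is void in the loop algebra and \<open>\<sigma> X\<^sub>i\<^sub>j\<close> is the centralizer of \<open>\<sigma> x\<^sub>i\<^sub>j\<close>,
  a free \<open>\<A>\<close>-module of rank one. On the other hand \<open>O\<close> is the free \<open>\<F>[t]\<close>-module on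
  \<open>x\<close>, \<open>y t\<close>, \<open>z (t - 1)\<close>. Comparing coordinates, each intersection consists of the
  \<open>\<F>[t]\<close>-multiples of one element, and the powers of \<open>t - 1\<close> are a basis of \<open>\<F>[t]\<close>.\<close>

section \<open>Polynomials in \<open>t - 1\<close>\<close>

text \<open>Evaluation at t - 1 rather than at t has the same image F[t], but it sends monomials to
  the powers of t - 1 in which the bases are stated.\<close>

definition poly_s :: "'f::field poly \<Rightarrow> 'f A_ring" where
  "poly_s p = poly (map_poly A_const p) (A_t - 1)"

lemma A_const_0 [simp]: "A_const 0 = 0"
  and A_const_1 [simp]: "A_const 1 = 1"
  by (simp_all add: A_const_simps)

lemma A_const_add: "A_const (a + b) = A_const a + A_const b"
  and A_const_mult: "A_const (a * b) = A_const a * A_const b"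
  by (simp_all add: A_const_simps)

lemma A_const_numeral: "A_const (2::'f::field) = 2"
  using A_const_add[of 1 "1::'f"] by simp

lemma poly_s_0 [simp]: "poly_s 0 = 0"
  by (simp add: poly_s_def)

lemma poly_s_pCons [simp]: "poly_s (pCons c p) = A_const c + (A_t - 1) * poly_s p"
  by (cases "c = 0 \<and> p = 0") (auto simp: poly_s_def map_poly_pCons)

lemma poly_s_add [simp]: "poly_s (p + q) = poly_s p + poly_s q"
  by (induction p q rule: poly_induct2) (simp_all add: A_const_add algebra_simps)

lemma poly_s_smult [simp]: "poly_s (smult c p) = A_const c * poly_s p"
  by (induction p) (simp_all add: A_const_mult algebra_simps)

lemma poly_s_uminus [simp]: "poly_s (- p) = - poly_s p"
  using poly_s_add[of p "- p"] by (simp add: eq_neg_iff_add_eq_0 add.commute del: poly_s_add)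

lemma poly_s_diff [simp]: "poly_s (p - q) = poly_s p - poly_s q"
  using poly_s_add[of p "- q"] by simp

lemma poly_s_mult [simp]: "poly_s (p * q) = poly_s p * poly_s q"
  by (induction p) (simp_all add: algebra_simps)

lemma poly_s_sum: "poly_s (sum g I) = (\<Sum>i\<in>I. poly_s (g i))"
  by (induction I rule: infinite_finite_induct) simp_all

lemma poly_s_monom [simp]: "poly_s (monom c i) = A_const c * (A_t - 1) ^ i"
  by (induction i) (simp_all add: monom_0 monom_Suc algebra_simps)

lemma poly_s_expand: "poly_s p = (\<Sum>i\<le>degree p. A_const (coeff p i) * (A_t - 1) ^ i)"
  by (subst poly_as_sum_of_monoms[symmetric]) (simp add: poly_s_sum)

text \<open>This serves injectivity: in the field of fractions \<open>poly_s\<close> becomes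
  composition with the nonconstant polynomial t - 1, which kills only 0.\<close>

lemma Rep_poly_s: "Rep_A_ring (poly_s p) = Fract (pcompose p [:- 1, 1:]) 1"
proof (induction p)
  case 0
  then show ?case by (simp add: zero_A_ring.rep_eq Zero_fract_def)
next
  case (pCons c p)
  then show ?case
    by (simp add: plus_A_ring.rep_eq times_A_ring.rep_eq minus_A_ring.rep_eq one_A_ring.rep_eq
        A_t.rep_eq A_const.rep_eq pcompose_pCons One_fract_def one_pCons)
qed

lemma poly_s_eq_0_iff [simp]: "poly_s p = 0 \<longleftrightarrow> p = 0"
proof
  assume "poly_s p = 0"
  then have "Fract (pcompose p [:- 1, 1:]) 1 = 0"
    by (metis Rep_poly_s zero_A_ring.rep_eq)
  then have "pcompose p [:- 1, 1:] = 0"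
    by (simp add: Zero_fract_def eq_fract)
  then show "p = 0"
    by (rule pcompose_eq_0) simp
qed simp

text \<open>The element 2 is a unit of F, hence of A, so it is nonzero and cancels in the domain
  A.\<close>

lemma two_mult_cancel [simp]:
  fixes a b :: "'f::field_char_0 A_ring"
  shows "2 * a = 2 * b \<longleftrightarrow> a = b"
proof -
  have "A_const (2::'f) * A_const (1 / 2) = 1"
    by (simp add: A_const_mult[symmetric])
  then have "(2 :: 'f A_ring) \<noteq> 0"
    by (auto simp: A_const_numeral)
  then show ?thesis by simp
qed

text \<open>Since A is a domain and \<open>w\<close> is nonzero, \<open>p\<close> \<mapsto>
  \<open>w \<odot> poly_s p\<close> is linear over F and injective, so it carries the monomial basis
  of the polynomial ring to a basis of its image.\<close>

lemma family_basis_powers: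
  fixes w :: "'f::field loop_sl2"
  assumes "w \<noteq> 0"
  shows "loop.family_basis (\<lambda>i. w \<odot> (A_t - 1) ^ i) (range (\<lambda>p. w \<odot> poly_s p))"
proof -
  let ?b = "\<lambda>i. w \<odot> (A_t - 1) ^ i"
  have mult_0: "w \<odot> a = 0 \<longleftrightarrow> a = 0" for a
    using assms by (cases w) (auto simp: loop_mult_def sl2_scale_def zero_sl2_def)
  have mult_sum: "w \<odot> sum g I = (\<Sum>i\<in>I. w \<odot> g i)" for g :: "nat \<Rightarrow> 'f A_ring" and I
  proof -
    have "w \<odot> (a + b) = w \<odot> a + w \<odot> b" for a b
      by (simp add: loop_mult_def sl2_scale_def sl2_arith algebra_simps)
    then show ?thesis
      by (induction I rule: infinite_finite_induct) (simp_all add: mult_0)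
  qed
  have mult_const: "w \<odot> (A_const c * a) = loop_scale c (w \<odot> a)" for c a
    by (simp add: loop_mult_def loop_scale_def sl2_scale_def mult.assoc)
  have inj: "inj ?b"
  proof (rule injI)
    fix i j assume "?b i = ?b j"
    then have "w \<odot> poly_s (monom 1 i - monom 1 j) = 0"
      by (simp add: loop_mult_def sl2_scale_def sl2_arith algebra_simps)
    then have "(monom 1 i :: 'f poly) = monom 1 j"
      unfolding mult_0 poly_s_eq_0_iff by simp
    then show "i = j" by (metis coeff_monom zero_neq_one)
  qed
  moreover have "loop.independent (range ?b)"
    unfolding loop.independent_explicit_finite_subsets
  proof (intro allI impI ballI)
    fix S c v
    assume S: "S \<subseteq> range ?b" "finite S" "(\<Sum>v\<in>S. loop_scale (c v) v) = 0" "v \<in> S"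
    obtain I where I: "finite I" "S = ?b ` I"
      using finite_subset_image[OF S(2,1)] by blast
    \<comment> \<open>A linear relation is the image of the one polynomial that has its scalars as
      coefficients; that polynomial is 0, and so is its coefficient at \<open>j\<close>.\<close>
    have "0 = (\<Sum>i\<in>I. loop_scale (c (?b i)) (?b i))"
      using S(3) unfolding I(2) by (simp add: sum.reindex inj_on_subset[OF inj])
    also have "\<dots> = w \<odot> poly_s (\<Sum>i\<in>I. monom (c (?b i)) i)"
      by (simp add: poly_s_sum mult_sum mult_const)
    finally have p: "(\<Sum>i\<in>I. monom (c (?b i)) i) = 0"
      by (metis mult_0 poly_s_eq_0_iff)
    obtain j where j: "j \<in> I" "v = ?b j" using I(2) S(4) by blast
    have "c (?b j) = coeff (\<Sum>i\<in>I. monom (c (?b i)) i) j"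
      using I(1) j(1) by (simp add: coeff_sum)
    then show "c v = 0" using p j by simp
  qed
  moreover have "loop.span (range ?b) = range (\<lambda>p. w \<odot> poly_s p)"
  proof
    have "loop.subspace (range (\<lambda>p. w \<odot> poly_s p))"
    proof (rule loop.subspaceI)
      show "0 \<in> range (\<lambda>p. w \<odot> poly_s p)"
        using mult_0[of 0] by (intro image_eqI[of _ _ 0]) auto
    next
      fix u v assume "u \<in> range (\<lambda>p. w \<odot> poly_s p)" "v \<in> range (\<lambda>p. w \<odot> poly_s p)"
      then obtain p q where "u = w \<odot> poly_s p" "v = w \<odot> poly_s q" by blast
      then show "u + v \<in> range (\<lambda>p. w \<odot> poly_s p)"
        by (intro image_eqI[of _ _ "p + q"])
          (simp_all add: loop_mult_def sl2_scale_def sl2_arith algebra_simps)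
    next
      fix c u assume "u \<in> range (\<lambda>p. w \<odot> poly_s p)"
      then obtain p where "u = w \<odot> poly_s p" by blast
      then show "loop_scale c u \<in> range (\<lambda>p. w \<odot> poly_s p)"
        by (intro image_eqI[of _ _ "smult c p"]) (simp_all add: mult_const)
    qed
    moreover have "range ?b \<subseteq> range (\<lambda>p. w \<odot> poly_s p)"
      by (auto intro!: image_eqI[of _ _ "monom 1 _"])
    ultimately show "loop.span (range ?b) \<subseteq> range (\<lambda>p. w \<odot> poly_s p)"
      by (simp add: loop.span_minimal)
  next
    show "range (\<lambda>p. w \<odot> poly_s p) \<subseteq> loop.span (range ?b)"
      by (auto simp: poly_s_expand mult_sum mult_const
          intro!: loop.span_sum loop.span_scale intro: loop.span_base)
  qed
  ultimately show ?thesis unfolding loop.family_basis_def by blast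
qed


section \<open>The Onsager algebra\<close>

text \<open>The arguments are coordinates with respect to X = x, Y = y t, Z = z (t - 1), written out
  in e, f, h. In these coordinates membership in O means that all three entries are polynomials in
  t.\<close>

definition ons_elt :: "'f::field A_ring \<Rightarrow> 'f A_ring \<Rightarrow> 'f A_ring \<Rightarrow> 'f loop_sl2" where
  "ons_elt p q r = SL2 (2 * p) (- 2 * (A_t * q)) (- p - A_t * q + (A_t - 1) * r)"

lemma ons_elt_tensor:
  "ons_elt p q r = sl2_x \<otimes> p + sl2_y \<otimes> (A_t * q) + sl2_z \<otimes> ((A_t - 1) * r)"
proof -
  have neg: "A_const (- c) = - A_const c" for c :: 'a
    using A_const_simps(5)[of 0 c] by simp
  show ?thesis
    by (simp add: ons_elt_def tensor_def sl2_x_def sl2_y_def sl2_z_def sl2_e_def sl2_f_def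
        sl2_h_def sl2_scale_def sl2_arith neg A_const_numeral)
qed

lemma ons_elt_add: "ons_elt p q r + ons_elt p' q' r' = ons_elt (p + p') (q + q') (r + r')"
  and ons_elt_scale: "loop_scale c (ons_elt p q r) =
    ons_elt (A_const c * p) (A_const c * q) (A_const c * r)"
  and ons_elt_mult: "ons_elt p q r \<odot> a = ons_elt (p * a) (q * a) (r * a)"
  and ons_elt_uminus: "- ons_elt p q r = ons_elt (- p) (- q) (- r)"
  and ons_elt_0: "ons_elt 0 0 0 = 0"
  by (simp_all add: ons_elt_def loop_scale_def loop_mult_def sl2_scale_def sl2_arith algebra_simps)

text \<open>This encodes [X, Y] = 2t X + 2Y, [Y, Z] = 2(t - 1) Y + 2t Z and [Z, X] = 2Z + 2(t - 1)
  X. All structure constants are polynomials in t, so the F[t]-span of X, Y, Z is closed under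
  brackets.\<close>

lemma ons_elt_bracket: "loop_bracket (ons_elt p q r) (ons_elt p' q' r') = ons_elt
    (2 * A_t * (p * q' - p' * q) - 2 * (A_t - 1) * (p * r' - p' * r))
    (2 * (p * q' - p' * q) + 2 * (A_t - 1) * (q * r' - q' * r))
    (2 * A_t * (q * r' - q' * r) - 2 * (p * r' - p' * r))"
  by (simp add: ons_elt_def loop_bracket_def sl2_bracket_def algebra_simps)

text \<open>Both t = 1 + (t - 1) and, in the next lemma, t - 1 itself are images of nonzero
  polynomials under the injective \<open>poly_s\<close>.\<close>

lemma A_t_neq_0 [simp]: "A_t \<noteq> (0 :: 'f::field A_ring)"
  using poly_s_eq_0_iff[of "[:1, 1:] :: 'f poly"] by (auto simp del: poly_s_eq_0_iff)

lemma A_t_neq_1 [simp]: "A_t \<noteq> (1 :: 'f::field A_ring)"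
  using poly_s_eq_0_iff[of "[:0, 1:] :: 'f poly"] by (auto simp del: poly_s_eq_0_iff)

lemma ons_elt_inject:
  fixes p q r :: "'f::field_char_0 A_ring"
  shows "ons_elt p q r = ons_elt p' q' r' \<longleftrightarrow> p = p' \<and> q = q' \<and> r = r'"
proof
  assume eq: "ons_elt p q r = ons_elt p' q' r'"
  then have "2 * p = 2 * p'" "2 * (A_t * q) = 2 * (A_t * q')"
    by (simp_all only: ons_elt_def sl2.inject) simp_all
  then have "p = p'" "A_t * q = A_t * q'" unfolding two_mult_cancel .
  moreover from this eq have "(A_t - 1) * r = (A_t - 1) * r'"
    by (simp only: ons_elt_def sl2.inject) simp
  ultimately show "p = p' \<and> q = q' \<and> r = r'"
    unfolding mult_cancel_left by simp
qed simp

lemma onsager_generators: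
  "sl2_x \<otimes> 1 = ons_elt 1 0 0" "sl2_y \<otimes> A_t + sl2_z \<otimes> (A_t - 1) = ons_elt 0 1 1"
  by (simp_all add: ons_elt_tensor tensor_def sl2_arith)

text \<open>Write \<open>X\<close>, \<open>Y\<close>, \<open>Z\<close> for the three coordinate vectors, with \<open>s = t - 1\<close>. Modulo elements
  already in \<open>S\<close>, three brackets yield \<open>X s\<^sup>n\<^sup>+\<^sup>2 + Y s\<^sup>n\<^sup>+\<^sup>1\<close>, \<open>X s\<^sup>n\<^sup>+\<^sup>2 + Z s\<^sup>n\<^sup>+\<^sup>1\<close> and
  \<open>Y s\<^sup>n\<^sup>+\<^sup>1 + Z s\<^sup>n\<^sup>+\<^sup>1\<close>, which can be solved for the summands since \<open>2\<close> is invertible.\<close>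
lemma subalgebra_powers:
  fixes S :: "'f::field_char_0 loop_sl2 set"
  assumes S: "loop.lie_subalgebra S" and gen: "ons_elt 1 0 0 \<in> S" "ons_elt 0 1 1 \<in> S"
  defines "s \<equiv> A_t - 1 :: 'f A_ring"
  shows "ons_elt (s ^ n) 0 0 \<in> S \<and> ons_elt 0 (s ^ n) 0 \<in> S \<and> ons_elt 0 0 (s ^ n) \<in> S
    \<and> ons_elt (s ^ Suc n) 0 0 \<in> S"
proof -
  have add: "u + v \<in> S" and diff: "u - v \<in> S" and brk: "loop_bracket u v \<in> S"
    if "u \<in> S" "v \<in> S" for u v
    using S that by (auto simp: loop.lie_subalgebra_def loop.subspace_add loop.subspace_diff)
  have half: "v \<in> S" if "v + v \<in> S" for v
  proof -
    have "A_const (1 / 2) * (a + a) = a" for a :: "'f A_ring"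
    proof -
      have "A_const (1 / 2) * (a + a) = (A_const (1 / 2) * A_const 2) * a"
        by (simp add: A_const_numeral algebra_simps)
      also have "\<dots> = a" by (simp add: A_const_mult[symmetric])
      finally show ?thesis .
    qed
    then have "loop_scale (1 / 2) (v + v) = v"
      by (cases v) (simp add: loop_scale_def sl2_scale_def plus_sl2_def)
    moreover have "loop_scale (1 / 2) (v + v) \<in> S"
      using S that by (auto simp: loop.lie_subalgebra_def loop.subspace_scale)
    ultimately show ?thesis by simp
  qed
  have t: "A_t = s + 1" by (simp add: s_def)
  note ons = ons_elt_bracket ons_elt_add t algebra_simps
  have minus: "ons_elt p q r - ons_elt p' q' r' = ons_elt (p - p') (q - q') (r - r')"
    for p q r p' q' r' :: "'f A_ring"
    using ons_elt_add[of p q r "- p'" "- q'" "- r'"] by (simp add: ons_elt_uminus[symmetric])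
  \<comment> \<open>Adding 2(Y + Z) to [X, Y + Z] cancels Z, and t - s = 1 leaves 2X + 4Y. This
    separates Y, and then Z, from the second generator.\<close>
  have "ons_elt 2 4 0 = loop_bracket (ons_elt 1 0 0) (ons_elt 0 1 1)
      + (ons_elt 0 1 1 + ons_elt 0 1 1)"
    by (simp add: ons)
  then have "ons_elt 2 4 0 \<in> S" by (metis add brk gen)
  then have "ons_elt 2 4 0 - (ons_elt 1 0 0 + ons_elt 1 0 0) \<in> S" using add diff gen by blast
  then have "(ons_elt 0 1 0 + ons_elt 0 1 0) + (ons_elt 0 1 0 + ons_elt 0 1 0) \<in> S"
    by (simp add: ons minus)
  then have Y0: "ons_elt 0 1 0 \<in> S" using half by blast
  then have Z0: "ons_elt 0 0 1 \<in> S" using diff[OF gen(2) Y0] by (simp add: minus)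
  \<comment> \<open>The induction keeps X one power of s ahead of Y and Z, because producing the
    next Y and Z takes a bracket with X s^(n+1).\<close>
  show ?thesis
  proof (induction n)
    case 0
    have "loop_bracket (ons_elt 1 0 0) (ons_elt 0 1 0)
        - (ons_elt 1 1 0 + ons_elt 1 1 0) = ons_elt s 0 0 + ons_elt s 0 0"
      by (simp add: ons minus)
    moreover have "ons_elt 1 1 0 \<in> S" using add[OF gen(1) Y0] by (simp add: ons)
    ultimately have "ons_elt s 0 0 \<in> S" by (metis add brk diff gen(1) half Y0)
    then show ?case using gen Y0 Z0 by simp
  next
    case (Suc n)
    let ?S = "s ^ Suc n" and ?SS = "s ^ Suc (Suc n)"
    have X: "ons_elt ?S 0 0 \<in> S" and Y: "ons_elt 0 (s ^ n) 0 \<in> S" and Z: "ons_elt 0 0 (s ^ n) \<in> S"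
      using Suc by auto
    have "loop_bracket (ons_elt ?S 0 0) (ons_elt 0 1 0) - (ons_elt ?S 0 0 + ons_elt ?S 0 0)
        = ons_elt ?SS ?S 0 + ons_elt ?SS ?S 0"
      by (simp add: ons minus)
    then have P: "ons_elt ?SS ?S 0 \<in> S" by (metis add brk diff half X Y0)
    have "loop_bracket (ons_elt 0 0 1) (ons_elt ?S 0 0)
        = ons_elt ?SS 0 ?S + ons_elt ?SS 0 ?S"
      by (simp add: ons)
    then have Q: "ons_elt ?SS 0 ?S \<in> S" by (metis brk half X Z0)
    have "loop_bracket (ons_elt 0 1 0) (ons_elt 0 0 (s ^ n))
        - (ons_elt 0 0 (s ^ n) + ons_elt 0 0 (s ^ n)) = ons_elt 0 ?S ?S + ons_elt 0 ?S ?S"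
      by (simp add: ons minus)
    then have R: "ons_elt 0 ?S ?S \<in> S" by (metis add brk diff half Y0 Z)
    have "ons_elt ?SS ?S 0 + ons_elt ?SS 0 ?S - ons_elt 0 ?S ?S = ons_elt ?SS 0 0 + ons_elt ?SS 0 0"
      by (simp add: ons minus)
    then have XX: "ons_elt ?SS 0 0 \<in> S" by (metis P Q R add diff half)
    have "ons_elt 0 ?S 0 \<in> S" using diff[OF P XX] by (simp add: minus)
    moreover have "ons_elt 0 0 ?S \<in> S" using diff[OF Q XX] by (simp add: minus)
    ultimately show ?case using X XX by blast
  qed
qed

text \<open>Polynomial structure constants make the right-hand side a subalgebra, and it contains
  both generators. Conversely, any subalgebra containing them has X, Y, Z times all powers of t - 1
  by \<open>subalgebra_powers\<close>, hence times all polynomials.\<close>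

lemma onsager_eq:
  "(onsager :: 'f::field_char_0 loop_sl2 set) =
    {ons_elt (poly_s p) (poly_s q) (poly_s r) | p q r. True}" (is "_ = ?M")
proof
  have "loop.subspace ?M"
  proof (rule loop.subspaceI)
    show "0 \<in> ?M" by (metis (mono_tags, lifting) mem_Collect_eq ons_elt_0 poly_s_0)
  next
    fix u v assume "u \<in> ?M" "v \<in> ?M"
    then show "u + v \<in> ?M" by (force simp: ons_elt_add poly_s_add[symmetric] simp del: poly_s_add)
  next
    fix c u assume "u \<in> ?M"
    then show "loop_scale c u \<in> ?M"
      by (force simp: ons_elt_scale poly_s_smult[symmetric] simp del: poly_s_smult)
  qed
  moreover have "loop_bracket u v \<in> ?M" if uv: "u \<in> ?M" "v \<in> ?M" for u v
  proof -
    obtain p q r p' q' r' where "u = ons_elt (poly_s p) (poly_s q) (poly_s r)"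
      "v = ons_elt (poly_s p') (poly_s q') (poly_s r')" using uv by blast
    \<comment> \<open>With the scalars in the bracket formula written as values of
      \<open>poly_s\<close>, each coordinate folds into a single value of
      \<open>poly_s\<close>.\<close>
    moreover have polys: "A_t = poly_s [:1, 1 :: 'f:]" "1 = poly_s [:1 :: 'f:]" "2 = poly_s [:2 :: 'f:]"
      by (simp_all add: A_const_numeral)
    ultimately show ?thesis
      by (simp only: ons_elt_bracket polys poly_s_mult[symmetric] poly_s_diff[symmetric]
          poly_s_add[symmetric]) blast
  qed
  moreover have "ons_elt 1 0 0 \<in> ?M"
    by (rule CollectI) (rule exI[of _ "[:1:]"], rule exI[of _ 0], rule exI[of _ 0], simp)
  moreover have "ons_elt 0 1 1 \<in> ?M"
    by (rule CollectI) (rule exI[of _ 0], rule exI[of _ "[:1:]"], rule exI[of _ "[:1:]"], simp)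
  ultimately show "onsager \<subseteq> ?M"
    unfolding onsager_def loop.generated_subalgebra_def onsager_generators
    by (intro Inter_lower) (auto simp: loop.lie_subalgebra_def)
next
  have "ons_elt (poly_s p) (poly_s q) (poly_s r) \<in> S"
    if S: "loop.lie_subalgebra S" "ons_elt 1 0 0 \<in> S" "ons_elt 0 1 1 \<in> S"
    for S :: "'f loop_sl2 set" and p q r
  proof -
    have sub: "loop.subspace S" using S(1) by (simp add: loop.lie_subalgebra_def)
    have powers: "w \<odot> poly_s g \<in> S" if "\<And>n. w \<odot> (A_t - 1) ^ n \<in> S" for w g
    proof (cases "w = 0")
      case True
      then show ?thesis
        using loop.subspace_0[OF sub] by (simp add: loop_mult_def sl2_scale_def zero_sl2_def)
    next
      case False
      have "w \<odot> poly_s g \<in> loop.span (range (\<lambda>n. w \<odot> (A_t - 1) ^ n))"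
        using family_basis_powers[OF False] by (auto simp: loop.family_basis_def)
      also have "\<dots> \<subseteq> S" by (rule loop.span_minimal[OF _ sub]) (use that in auto)
      finally show ?thesis .
    qed
    have "ons_elt (poly_s p) 0 0 \<in> S" "ons_elt 0 (poly_s q) 0 \<in> S" "ons_elt 0 0 (poly_s r) \<in> S"
      using powers[of "ons_elt 1 0 0" p] powers[of "ons_elt 0 1 0" q] powers[of "ons_elt 0 0 1" r]
        subalgebra_powers[OF S] by (simp_all add: ons_elt_mult)
    from loop.subspace_add[OF sub loop.subspace_add[OF sub this(1,2)] this(3)]
    show ?thesis by (simp add: ons_elt_add)
  qed
  then show "?M \<subseteq> onsager"
    unfolding onsager_def loop.generated_subalgebra_def onsager_generators by auto
qed


section \<open>Centralizers\<close>

text \<open>The assumption says that the 2 by 2 matrix of \<open>u\<close> has determinant -1. Then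
  ad u has characteristic polynomial T^3 - 4T, and the claim is the Cayley-Hamilton
  identity.\<close>

lemma sl2_ad_cubed:
  assumes "coef_h u * coef_h u + coef_e u * coef_f u = (1 :: 'f::field A_ring)"
  shows "loop_bracket u (loop_bracket u (loop_bracket u v)) = loop_scale 4 (loop_bracket u v)"
proof -
  have "A_const (4 :: 'f) = 4"
    using A_const_add[of 2 "2::'f"] by (simp add: A_const_numeral)
  moreover have "loop_bracket u (loop_bracket u (loop_bracket u v)) =
      sl2_scale (4 * (coef_h u * coef_h u + coef_e u * coef_f u)) (loop_bracket u v)"
    by (simp add: loop_bracket_def sl2_bracket_def sl2_scale_def algebra_simps)
  ultimately show ?thesis
    using assms by (simp add: loop_scale_def)
qed

text \<open>Injectivity of \<open>\<sigma>\<close> lets both defining conditions be tested in the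
  loop algebra, where \<open>cubic\<close> makes the second automatic; surjectivity then gives the
  whole centralizer.\<close>

lemma sigma_image_tetra_X:
  fixes \<sigma> :: "'f::field_char_0 tetra \<Rightarrow> 'f loop_sl2"
  assumes \<sigma>: "lie_iso tetra_scale tetra_bracket loop_scale loop_bracket \<sigma>"
    and cubic: "\<And>h k. {h, i, j, k} = II \<Longrightarrow> (let u = \<sigma> (tetra_x k h) in
      coef_h u * coef_h u + coef_e u * coef_f u = 1)"
  shows "\<sigma> ` tetra_X i j = {v. loop_bracket (\<sigma> (tetra_x i j)) v = 0}"
proof -
  have bij: "bij \<sigma>" and brk: "\<sigma> (tetra_bracket a b) = loop_bracket (\<sigma> a) (\<sigma> b)"
    and scale: "\<sigma> (tetra_scale c a) = loop_scale c (\<sigma> a)"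
    and zero: "\<sigma> 0 = 0" for a b c
    using \<sigma> by (auto simp: lie_iso_def lie_hom_def linear_iff_module_hom module_hom.zero
        module_hom.scale)
  note inj = bij_is_inj[OF bij, THEN inj_eq, symmetric]
  have "\<xi> \<in> tetra_X i j \<longleftrightarrow> loop_bracket (\<sigma> (tetra_x i j)) (\<sigma> \<xi>) = 0" for \<xi>
    using cubic unfolding tetra_X_def inj by (auto simp: Let_def brk scale zero sl2_ad_cubed)
  then show ?thesis
    using bij_is_surj[OF bij] by (force simp: surj_def)
qed

lemma centralizer_21:
  fixes v :: "'f::field_char_0 loop_sl2"
  shows "loop_bracket (ons_elt (- 1) 0 0) v = 0 \<longleftrightarrow> v \<in> range (\<lambda>a. ons_elt (- 1) 0 0 \<odot> a)"
proof
  assume "loop_bracket (ons_elt (- 1) 0 0) v = 0"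
  then have "2 * (coef_e v + 2 * coef_h v) = 2 * 0" "2 * coef_f v = 2 * 0"
    by (auto simp: loop_bracket_def sl2_bracket_def ons_elt_def zero_sl2_def algebra_simps)
  then have "coef_e v = - 2 * coef_h v" "coef_f v = 0"
    unfolding two_mult_cancel by (simp_all add: eq_neg_iff_add_eq_0)
  \<comment> \<open>The generator -x has h-coordinate 1, so the multiplier is the h-coordinate of
    \<open>v\<close>; the same choice works in \<open>centralizer_30\<close>.\<close>
  then have "v = ons_elt (- 1) 0 0 \<odot> coef_h v"
    by (cases v) (simp add: ons_elt_def loop_mult_def sl2_scale_def)
  then show "v \<in> range (\<lambda>a. ons_elt (- 1) 0 0 \<odot> a)" by blast
qed (auto simp: loop_bracket_def sl2_bracket_def ons_elt_def zero_sl2_def loop_mult_def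
    sl2_scale_def algebra_simps)

lemma centralizer_30:
  fixes v :: "'f::field_char_0 loop_sl2"
  shows "loop_bracket (ons_elt 0 (- 1) (- 1)) v = 0 \<longleftrightarrow>
    v \<in> range (\<lambda>a. ons_elt 0 (- 1) (- 1) \<odot> a)"
proof
  assume "loop_bracket (ons_elt 0 (- 1) (- 1)) v = 0"
  then have "2 * coef_e v = 2 * 0" "2 * (coef_f v) = 2 * (2 * A_t * coef_h v)"
    by (auto simp: loop_bracket_def sl2_bracket_def ons_elt_def zero_sl2_def algebra_simps)
  then have "coef_e v = 0" "coef_f v = 2 * A_t * coef_h v"
    unfolding two_mult_cancel by simp_all
  then have "v = ons_elt 0 (- 1) (- 1) \<odot> coef_h v"
    by (cases v) (simp add: ons_elt_def loop_mult_def sl2_scale_def algebra_simps)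
  then show "v \<in> range (\<lambda>a. ons_elt 0 (- 1) (- 1) \<odot> a)" by blast
qed (auto simp: loop_bracket_def sl2_bracket_def ons_elt_def zero_sl2_def loop_mult_def
    sl2_scale_def algebra_simps)

lemma centralizer_02:
  fixes v :: "'f::field_char_0 loop_sl2"
  shows "loop_bracket (ons_elt (- 1) (- 1) 0) v = 0 \<longleftrightarrow>
    v \<in> range (\<lambda>a. ons_elt (- 1) (- 1) 0 \<odot> a)"
proof
  assume "loop_bracket (ons_elt (- 1) (- 1) 0) v = 0"
  then have eqs: "2 * ((A_t + 1) * coef_e v) = 2 * (- 2 * coef_h v)"
    "2 * coef_f v = 2 * (- A_t * coef_e v)"
    by (auto simp: loop_bracket_def sl2_bracket_def ons_elt_def zero_sl2_def
        eq_neg_iff_add_eq_0 neg_eq_iff_add_eq_0 algebra_simps)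
  \<comment> \<open>The h-coordinate t + 1 of this generator is not a unit of A, so the multiplier
    is read off from the e-coordinate, which is the unit -2.\<close>
  define a where "a = A_const (- 1 / 2) * coef_e v"
  have "A_const (2 :: 'f) * A_const (- 1 / 2) = A_const (- 1)"
    by (simp add: A_const_mult[symmetric])
  moreover have "A_const (- 1 :: 'f) = - 1"
    using A_const_simps(5)[of 0 "1::'f"] by simp
  ultimately have "2 * a = - coef_e v"
    by (simp add: a_def A_const_numeral mult.assoc[symmetric])
  then have e: "coef_e v = - 2 * a" by simp
  then have f: "coef_f v = 2 * A_t * a" using eqs(2) by (simp only: two_mult_cancel) simp
  have "2 * (2 * coef_h v) = 2 * (2 * ((A_t + 1) * a))"
    using eqs(1) e by (simp add: algebra_simps del: two_mult_cancel)
  then have "coef_h v = (A_t + 1) * a" unfolding two_mult_cancel .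
  with e f have "v = ons_elt (- 1) (- 1) 0 \<odot> a"
    by (cases v) (simp add: ons_elt_def loop_mult_def sl2_scale_def algebra_simps)
  then show "v \<in> range (\<lambda>a. ons_elt (- 1) (- 1) 0 \<odot> a)" by blast
qed (auto simp: loop_bracket_def sl2_bracket_def ons_elt_def zero_sl2_def loop_mult_def
    sl2_scale_def algebra_simps)

section \<open>Images of the generators under sigma and the intersections with O\<close>

lemma A_t''_mult: "A_t'' * (1 - A_t) = (1 :: 'f::field A_ring)"
proof -
  have "Tfr \<noteq> (1 :: 'f poly fract)"
    by (simp add: One_fract_def eq_fract one_pCons)
  then show ?thesis
    by transfer (simp add: field_simps)
qed

lemma sigma_values:
  fixes \<sigma> :: "'f::field_char_0 tetra \<Rightarrow> 'f loop_sl2"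
  assumes "is_sigma \<sigma>"
  shows "\<sigma> (tetra_x 1 2) = ons_elt 1 0 0" "\<sigma> (tetra_x 2 1) = ons_elt (- 1) 0 0"
    "\<sigma> (tetra_x 0 3) = ons_elt 0 1 1" "\<sigma> (tetra_x 3 0) = ons_elt 0 (- 1) (- 1)"
    "\<sigma> (tetra_x 3 1) = sl2_z \<otimes> 1" "\<sigma> (tetra_x 1 3) = - (sl2_z \<otimes> 1)"
    "\<sigma> (tetra_x 0 2) = ons_elt (- 1) (- 1) 0 \<odot> (- A_t'')"
proof -
  have lin: "Vector_Spaces.linear tetra_scale loop_scale \<sigma>"
    using assms by (simp add: is_sigma_def lie_iso_def lie_hom_def)
  have skew: "\<sigma> (tetra_x j i) = - \<sigma> (tetra_x i j)" if "i \<in> II" "j \<in> II" "i \<noteq> j" for i j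
  proof -
    have "tetra_x i j + tetra_x j i = (0 :: 'f tetra)"
      using tetra_relations_tetra that unfolding tetra_relations_def by blast
    then have "tetra_x j i = - (tetra_x i j :: 'f tetra)"
      by (simp add: eq_neg_iff_add_eq_0 add.commute)
    then show ?thesis
      using lin by (simp add: linear_iff_module_hom module_hom.neg)
  qed
  show x: "\<sigma> (tetra_x 1 2) = ons_elt 1 0 0" and b: "\<sigma> (tetra_x 0 3) = ons_elt 0 1 1"
    and z: "\<sigma> (tetra_x 3 1) = sl2_z \<otimes> 1"
    using assms by (simp_all add: is_sigma_def onsager_generators)
  show "\<sigma> (tetra_x 2 1) = ons_elt (- 1) 0 0" "\<sigma> (tetra_x 3 0) = ons_elt 0 (- 1) (- 1)"
    "\<sigma> (tetra_x 1 3) = - (sl2_z \<otimes> 1)"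
    using skew[of 1 2] skew[of 0 3] skew[of 3 1] x b z
    by (simp_all add: II_def ons_elt_uminus)
  \<comment> \<open>This identity exhibits the image of \<open>tetra_x 0 2\<close> as a multiple of
    -x - y t, the vector treated in \<open>centralizer_02\<close>.\<close>
  have "(A_t'' - 1 :: 'f A_ring) = A_t * A_t''"
    using A_t''_mult[where 'f = 'f] by (simp add: algebra_simps)
  then have "\<sigma> (tetra_x 0 2) = sl2_x \<otimes> A_t'' + sl2_y \<otimes> (A_t * A_t'')"
    using assms by (simp add: is_sigma_def)
  then show "\<sigma> (tetra_x 0 2) = ons_elt (- 1) (- 1) 0 \<odot> (- A_t'')"
    by (simp add: ons_elt_tensor tensor_def sl2_arith loop_mult_def sl2_scale_def algebra_simps)
qed

text \<open>Each coordinate of the generator is 0 or -1 and at least one is -1. Comparing that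
  coordinate shows that a multiple by \<open>a\<close> lies in O only if \<open>a\<close> itself is
  a polynomial in t.\<close>

lemma centralizer_inter_onsager:
  fixes C :: "'f::field_char_0 loop_sl2 set"
  assumes C: "C = range (\<lambda>a. ons_elt p q r \<odot> a)"
    and pqr: "p \<in> {0, - 1}" "q \<in> {0, - 1}" "r \<in> {0, - 1}" "ons_elt p q r \<noteq> 0"
  shows "loop.family_basis (\<lambda>i. ons_elt p q r \<odot> (A_t - 1) ^ i) (C \<inter> onsager)"
proof -
  have "C \<inter> onsager = range (\<lambda>g. ons_elt p q r \<odot> poly_s g)"
  proof (intro equalityI subsetI)
    fix v assume "v \<in> C \<inter> onsager"
    then obtain a p' q' r' where v: "v = ons_elt p q r \<odot> a"
      and eq: "ons_elt p q r \<odot> a = ons_elt (poly_s p') (poly_s q') (poly_s r')"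
      unfolding C onsager_eq by auto
    then have eqs: "p * a = poly_s p'" "q * a = poly_s q'" "r * a = poly_s r'"
      by (simp_all add: ons_elt_mult ons_elt_inject)
    have "p = - 1 \<or> q = - 1 \<or> r = - 1" using pqr ons_elt_0 by auto
    then have "- a = poly_s p' \<or> - a = poly_s q' \<or> - a = poly_s r'"
      using eqs by auto
    then have "a = poly_s (- p') \<or> a = poly_s (- q') \<or> a = poly_s (- r')"
      by (simp only: poly_s_uminus) (metis minus_minus)
    then show "v \<in> range (\<lambda>g. ons_elt p q r \<odot> poly_s g)" using v by blast
  next
    fix v assume "v \<in> range (\<lambda>g. ons_elt p q r \<odot> poly_s g)"
    then obtain g where v: "v = ons_elt p q r \<odot> poly_s g" by blast
    have *: "d * poly_s g = poly_s (if d = 0 then 0 else - g)" if "d \<in> {0, - 1}" for d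
      using that by auto
    have "v \<in> onsager"
      unfolding v ons_elt_mult pqr(1-3)[THEN *] onsager_eq by blast
    then show "v \<in> C \<inter> onsager" using v C by blast
  qed
  then show ?thesis using family_basis_powers[OF pqr(4)] by simp
qed

theorem lemma7p2:
  fixes \<sigma> :: "'f::field_char_0 tetra \<Rightarrow> 'f loop_sl2"
  assumes "is_sigma \<sigma>"
  shows "loop.family_basis A_dd (\<sigma> ` tetra_X 2 1 \<inter> onsager)
    \<and> loop.family_basis B_dd (\<sigma> ` tetra_X 3 0 \<inter> onsager)
    \<and> loop.family_basis (\<lambda>i. psi_dd (i + 1)) (\<sigma> ` tetra_X 0 2 \<inter> onsager)"
proof -
  note \<sigma> = sigma_values[OF assms]
  have iso: "lie_iso tetra_scale tetra_bracket loop_scale loop_bracket \<sigma>"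
    using assms by (simp add: is_sigma_def)
  have A: "A_dd = (\<lambda>i. ons_elt (- 1) 0 0 \<odot> (A_t - 1) ^ i :: 'f loop_sl2)"
    by (simp add: fun_eq_iff A_dd_def ons_elt_tensor tensor_def sl2_arith loop_mult_def
        sl2_scale_def)
  have B: "B_dd = (\<lambda>i. ons_elt 0 (- 1) (- 1) \<odot> (A_t - 1) ^ i :: 'f loop_sl2)"
    by (simp add: fun_eq_iff B_dd_def ons_elt_tensor tensor_def sl2_arith loop_mult_def
        sl2_scale_def algebra_simps)
  \<comment> \<open>The shift by one turns the exponent of t - 1 into \<open>i\<close>, so only
    ordinary powers occur.\<close>
  have psi: "(\<lambda>i. psi_dd (i + 1)) = (\<lambda>i. ons_elt (- 1) (- 1) 0 \<odot> (A_t - 1) ^ i :: 'f loop_sl2)"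
    by (simp add: fun_eq_iff psi_dd_def A_t1_powi_of_nat ons_elt_tensor tensor_def sl2_arith)
  have nz: "ons_elt (- 1) 0 0 \<noteq> (0 :: 'f loop_sl2)" "ons_elt 0 (- 1) (- 1) \<noteq> (0 :: 'f loop_sl2)"
    "ons_elt (- 1) (- 1) 0 \<noteq> (0 :: 'f loop_sl2)"
    unfolding ons_elt_0[symmetric] ons_elt_inject by simp_all
  \<comment> \<open>The cubic condition ranges over both orderings of the complementary pair of
    indices.\<close>
  have hk: "h = a \<and> k = b \<or> h = b \<and> k = a"
    if "{h, i, j, k} = II" "II = {a, i, j, b}" "distinct [a, i, j, b]" for h i j k a b :: nat
    using that
    by (metis distinct.simps(2) empty_iff insert_iff list.set(1,2))
  have "\<sigma> ` tetra_X 2 1 = {v. loop_bracket (\<sigma> (tetra_x 2 1)) v = 0}"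
  proof (rule sigma_image_tetra_X[OF iso])
    fix h k assume "{h, 2, 1, k} = II"
    then have "h = 0 \<and> k = 3 \<or> h = 3 \<and> k = 0" by (rule hk) (auto simp: II_def)
    then show "let u = \<sigma> (tetra_x k h) in coef_h u * coef_h u + coef_e u * coef_f u = 1"
      by (auto simp: \<sigma> ons_elt_def Let_def algebra_simps)
  qed
  then have 21: "\<sigma> ` tetra_X 2 1 = range (\<lambda>a. ons_elt (- 1) 0 0 \<odot> a)"
    unfolding \<sigma> centralizer_21 by simp
  have "\<sigma> ` tetra_X 3 0 = {v. loop_bracket (\<sigma> (tetra_x 3 0)) v = 0}"
  proof (rule sigma_image_tetra_X[OF iso])
    fix h k assume "{h, 3, 0, k} = II"
    then have "h = 1 \<and> k = 2 \<or> h = 2 \<and> k = 1" by (rule hk) (auto simp: II_def)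
    then show "let u = \<sigma> (tetra_x k h) in coef_h u * coef_h u + coef_e u * coef_f u = 1"
      using \<sigma> by (auto simp: ons_elt_def Let_def algebra_simps)
  qed
  then have 30: "\<sigma> ` tetra_X 3 0 = range (\<lambda>a. ons_elt 0 (- 1) (- 1) \<odot> a)"
    unfolding \<sigma> centralizer_30 by simp
  have "\<sigma> ` tetra_X 0 2 = {v. loop_bracket (\<sigma> (tetra_x 0 2)) v = 0}"
  proof (rule sigma_image_tetra_X[OF iso])
    fix h k assume "{h, 0, 2, k} = II"
    then have "h = 1 \<and> k = 3 \<or> h = 3 \<and> k = 1" by (rule hk) (auto simp: II_def)
    then show "let u = \<sigma> (tetra_x k h) in coef_h u * coef_h u + coef_e u * coef_f u = 1"
      using \<sigma> by (auto simp: tensor_def sl2_z_def sl2_h_def sl2_arith Let_def)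
  qed
  moreover have "loop_bracket (w \<odot> (- A_t'')) v = 0 \<longleftrightarrow> loop_bracket w v = 0" for w v :: "'f loop_sl2"
  proof -
    have "(A_t'' :: 'f A_ring) \<noteq> 0"
      using A_t''_mult[where 'f = 'f] by auto
    moreover have "loop_bracket (w \<odot> (- A_t'')) v = loop_bracket w v \<odot> (- A_t'')"
      by (simp add: loop_bracket_def loop_mult_def sl2_bracket_def sl2_scale_def algebra_simps)
    ultimately show ?thesis
      by (cases "loop_bracket w v") (simp add: loop_mult_def sl2_scale_def zero_sl2_def)
  qed
  ultimately have 02: "\<sigma> ` tetra_X 0 2 = range (\<lambda>a. ons_elt (- 1) (- 1) 0 \<odot> a)"
    by (simp only: \<sigma> centralizer_02 Collect_mem_eq)
  show ?thesis
    unfolding A B psi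
    using centralizer_inter_onsager[OF 21 _ _ _ nz(1)] centralizer_inter_onsager[OF 30 _ _ _ nz(2)]
      centralizer_inter_onsager[OF 02 _ _ _ nz(3)] by simp
qed

end
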